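(* Let $n\ge 1$, let $\alpha\subset\{1,\dots,n\}\times\{1,\dots,n\}$, let $\Sigma_\alpha$ be the associated sparse matrix space and let $G$ be the associated directed graph. If $\Sigma_\alpha$ is stable, then every vertex of $G$ belongs to a strongly connected component of $G$ that contains a sink (a vertex with a self-loop).
   Context: For $\alpha\subset\{1,\dots,n\}\times\{1,\dots,n\}$, the sparse matrix space (SMS) $\Sigma_\alpha\subset\mathbb{R}^{n\times n}$ is the vector space of real $n\times n$ matrices $A=(a_{ij})$ with $a_{ij}=0$ whenever $(i,j)\notin\alpha$ (the entries indexed by $\alpha$ are free). A real square matrix is stable if all its eigenvalues have strictly negative real part. An SMS is stable if it contains a stable matrix, and unstable otherwise. The directed graph associated to $\Sigma_\alpha$ has vertices $v_1,\dots,v_n$ and an edge $(v_i,v_j)$ from $v_i$ to $v_j$ exactly when $(i,j)\in\alpha$; self-loops are allowed. A self-loop is an edge that starts and ends at the same vertex, and a sink is a vertex with a self-loop. A strongly connected component is a maximal subgraph in which there is a directed path from any vertex to any other vertex (a single vertex may form a component). *)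

theory Defs
  imports
    Complex_Main
    "Jordan_Normal_Form.Char_Poly"
    "Graph_Theory.Digraph_Component"
begin

(* Index pairs range over {1..n} x {1..n}, whereas the entries of a matrix in
   carrier_mat n n are indexed from 0; hence the shift by one. *)
definition SMS :: "nat \<Rightarrow> (nat \<times> nat) set \<Rightarrow> real mat set" where
  "SMS n \<alpha> = {A \<in> carrier_mat n n.
     \<forall>i\<in>{1..n}. \<forall>j\<in>{1..n}. (i, j) \<notin> \<alpha> \<longrightarrow> A $$ (i - 1, j - 1) = 0}"

(* The eigenvalues of a real matrix are its complex eigenvalues. *)
definition stable_mat :: "real mat \<Rightarrow> bool" where
  "stable_mat A \<longleftrightarrow> square_mat A \<and>
     (\<forall>z. eigenvalue (map_mat complex_of_real A) z \<longrightarrow> Re z < 0)"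

definition stable_space :: "real mat set \<Rightarrow> bool" where
  "stable_space S \<longleftrightarrow> (\<exists>A\<in>S. stable_mat A)"

definition sms_digraph :: "nat \<Rightarrow> (nat \<times> nat) set \<Rightarrow> (nat, nat \<times> nat) pre_digraph" where
  "sms_digraph n \<alpha> = \<lparr>verts = {1..n}, arcs = \<alpha>, tail = fst, head = snd\<rparr>"

(* A sink here is a vertex carrying a self-loop; it may have further outgoing edges. *)
definition is_sink :: "('a, 'b) pre_digraph \<Rightarrow> 'a \<Rightarrow> bool" where
  "is_sink G v \<longleftrightarrow> v \<in> verts G \<and> (\<exists>e\<in>arcs G. tail G e = v \<and> head G e = v)"

end

theory Submission
  imports
    Defs
    "Jordan_Normal_Form.Schur_Decomposition"
begin

text \<open>
  Fix a stable matrix \<open>A\<close> of the space and a vertex \<open>v\<close>, and let \<open>S\<close> be the set of vertices of the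
  strongly connected component of \<open>v\<close>. It suffices that the principal block of \<open>A\<close> on \<open>S\<close> has a nonzero
  diagonal entry, since the sparsity pattern turns such an entry into a self-loop. This holds because
  the block is itself stable (\<open>eigenvalue_diagonal_block\<close>), so that its trace, which is the sum of
  its eigenvalues with multiplicity, has negative real part (\<open>Re_trace_neg\<close>).

  The block inherits its eigenvalues from \<open>A\<close> because, with the vertices ordered suitably, \<open>A\<close> is
  block triangular and the block sits on the diagonal. No ordering is chosen here. Instead, call a
  set of indices closed if no nonzero entry of \<open>A\<close> has its row inside it and its column outside it;
  this is the case whenever no edge leaves the set. Let \<open>R\<close> consist of the vertices reachable from \<open>v\<close>. Then \<open>R\<close> is closed,
  and so is \<open>R - S\<close>: a vertex of \<open>R\<close> outside \<open>S\<close> cannot reach \<open>v\<close>, hence neither can its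
  successors. For a closed set \<open>R\<close>, the vectors vanishing on \<open>R\<close> form an invariant
  subspace, so the block on \<open>S\<close> is the map that \<open>A\<close> induces on the quotient of the subspace belonging
  to \<open>R - S\<close> by the one belonging to \<open>R\<close>. If \<open>\<lambda>\<close> is no eigenvalue of \<open>A\<close>, then \<open>A - \<lambda>\<close> is
  bijective on both subspaces, thus also on the quotient (\<open>vanishes_on_closed_set\<close>).
\<close>

section \<open>Trace and eigenvalues\<close>

lemma trace_mult_commute:
  fixes A B :: "'a :: comm_semiring_0 mat"
  assumes "A \<in> carrier_mat n m" "B \<in> carrier_mat m n"
  shows "(\<Sum>i<n. (A * B) $$ (i, i)) = (\<Sum>i<m. (B * A) $$ (i, i))"
proof -
  have "(\<Sum>i<n. (A * B) $$ (i, i)) = (\<Sum>i<n. \<Sum>j<m. A $$ (i, j) * B $$ (j, i))"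
    using assms by (intro sum.cong) (auto simp: scalar_prod_def atLeast0LessThan)
  also have "\<dots> = (\<Sum>j<m. \<Sum>i<n. B $$ (j, i) * A $$ (i, j))"
    by (subst sum.swap) (simp add: mult.commute)
  also have "\<dots> = (\<Sum>i<m. (B * A) $$ (i, i))"
    using assms by (intro sum.cong) (auto simp: scalar_prod_def atLeast0LessThan)
  finally show ?thesis .
qed

lemma trace_similar:
  fixes A B :: "'a :: comm_ring_1 mat"
  assumes A: "A \<in> carrier_mat n n" and "similar_mat A B"
  shows "(\<Sum>i<n. A $$ (i, i)) = (\<Sum>i<n. B $$ (i, i))"
proof -
  obtain P Q where "similar_mat_wit A B P Q"
    using assms(2) unfolding similar_mat_def by blast
  note w = similar_mat_witD2[OF A this]
  have "(\<Sum>i<n. A $$ (i, i)) = (\<Sum>i<n. (P * (B * Q)) $$ (i, i))"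
    using w by (simp add: assoc_mult_mat[OF w(6,5,7)])
  also have "\<dots> = (\<Sum>i<n. ((B * Q) * P) $$ (i, i))"
    using w by (intro trace_mult_commute) auto
  also have "(B * Q) * P = B"
    using w by (simp add: assoc_mult_mat[OF w(5,7,6)])
  finally show ?thesis .
qed

text \<open>The Schur form is upper triangular and similar to the matrix, so its diagonal entries are
  eigenvalues and their sum is the trace.\<close>

lemma Re_trace_neg:
  fixes A :: "complex mat"
  assumes A: "A \<in> carrier_mat n n" and "n > 0"
    and neg: "\<And>z. eigenvalue A z \<Longrightarrow> Re z < 0"
  shows "Re (\<Sum>i<n. A $$ (i, i)) < 0"
proof -
  obtain es where es: "char_poly A = (\<Prod>a\<leftarrow>es. [:- a, 1:])"
    using char_poly_factorized[OF A] by blast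
  define B where "B = schur_upper_triangular A es"
  have B: "B \<in> carrier_mat n n" "upper_triangular B" "similar_mat A B"
    using schur_upper_triangular[OF A es] unfolding B_def by auto
  have "Re (B $$ (i, i)) < 0" if "i < n" for i
  proof (rule neg)
    have "char_poly A = (\<Prod>a\<leftarrow>diag_mat B. [:- a, 1:])"
      using char_poly_similar[OF B(3)] char_poly_upper_triangular[OF B(1,2)] by simp
    moreover have "B $$ (i, i) \<in> set (diag_mat B)"
      using that B(1) by (auto simp: diag_mat_def)
    ultimately show "eigenvalue A (B $$ (i, i))"
      unfolding eigenvalue_root_char_poly[OF A]
      by (force simp: poly_prod_list prod_list_zero_iff)
  qed
  then have "(\<Sum>i<n. Re (B $$ (i, i))) < (\<Sum>i<n. 0)"
    using \<open>n > 0\<close> by (intro sum_strict_mono) auto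
  then show ?thesis
    using trace_similar[OF A B(3)] by simp
qed

section \<open>Diagonal blocks of block triangular matrices\<close>

text \<open>The matrix \<open>N\<close> that agrees with \<open>M\<close> on the rows outside \<open>R\<close> and with the identity on the rows
  in \<open>R\<close> is injective because \<open>M\<close> is, hence surjective. A preimage under \<open>N\<close> of \<open>M *\<^sub>v x\<close> vanishes on
  \<open>R\<close> and is also a preimage under \<open>M\<close>, so it is \<open>x\<close>.\<close>

lemma vanishes_on_closed_set:
  fixes M :: "'a :: field mat"
  assumes M: "M \<in> carrier_mat n n"
    and ker: "\<And>x. x \<in> carrier_vec n \<Longrightarrow> M *\<^sub>v x = 0\<^sub>v n \<Longrightarrow> x = 0\<^sub>v n"
    and closed: "\<And>i j. i < n \<Longrightarrow> j < n \<Longrightarrow> i \<in> R \<Longrightarrow> j \<notin> R \<Longrightarrow> M $$ (i, j) = 0"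
    and x: "x \<in> carrier_vec n" and zero: "\<And>i. i < n \<Longrightarrow> i \<in> R \<Longrightarrow> (M *\<^sub>v x) $ i = 0"
    and "i < n" "i \<in> R"
  shows "x $ i = 0"
proof -
  define N where "N = mat n n (\<lambda>(i, j). if i \<in> R then (if i = j then 1 else 0) else M $$ (i, j))"
  have N: "N \<in> carrier_mat n n"
    by (simp add: N_def)
  have N_in: "(N *\<^sub>v z) $ i = z $ i" if "z \<in> carrier_vec n" "i < n" "i \<in> R" for z i
    using that by (simp add: N_def scalar_prod_def if_distrib[where f = "\<lambda>c. c * _"] cong: if_cong)
  have N_out: "(N *\<^sub>v z) $ i = (M *\<^sub>v z) $ i" if "z \<in> carrier_vec n" "i < n" "i \<notin> R" for z i
    using that M by (simp add: N_def scalar_prod_def)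
  have M_in: "(M *\<^sub>v z) $ i = 0"
    if "z \<in> carrier_vec n" "\<And>j. j < n \<Longrightarrow> j \<in> R \<Longrightarrow> z $ j = 0" "i < n" "i \<in> R" for z i
  proof -
    have "M $$ (i, j) * z $ j = 0" if "j < n" for j
      using that \<open>\<And>j. j < n \<Longrightarrow> j \<in> R \<Longrightarrow> z $ j = 0\<close> closed[OF \<open>i < n\<close> that \<open>i \<in> R\<close>]
      by (cases "j \<in> R") auto
    then show ?thesis
      using that M by (auto simp: scalar_prod_def intro!: sum.neutral)
  qed
  have "det N \<noteq> 0"
  proof
    assume "det N = 0"
    then obtain z where z: "z \<in> carrier_vec n" "z \<noteq> 0\<^sub>v n" "N *\<^sub>v z = 0\<^sub>v n"
      using det_0_iff_vec_prod_zero_field[OF N] by blast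
    have z_in: "z $ j = 0" if "j < n" "j \<in> R" for j
      using N_in[OF z(1) that] z(3) that by simp
    have "M *\<^sub>v z = 0\<^sub>v n"
    proof (rule eq_vecI)
      fix i assume "i < dim_vec (0\<^sub>v n :: 'a vec)"
      then show "(M *\<^sub>v z) $ i = 0\<^sub>v n $ i"
        using M_in[OF z(1) z_in] N_out[OF z(1)] z(3) by (cases "i \<in> R") auto
    qed (use M in simp)
    with ker[OF z(1)] z(2) show False by blast
  qed
  then obtain N' where N': "N' \<in> carrier_mat n n" "N * N' = 1\<^sub>m n"
    using det_non_zero_imp_unit[OF N, of "()"] by (auto simp: Units_def ring_mat_def)
  define y where "y = N' *\<^sub>v (M *\<^sub>v x)"
  have y: "y \<in> carrier_vec n"
    using N' M x by (simp add: y_def)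
  have Ny: "N *\<^sub>v y = M *\<^sub>v x"
    using N N' M x assoc_mult_mat_vec[OF N N'(1), of "M *\<^sub>v x"] by (simp add: y_def)
  have y_in: "y $ j = 0" if "j < n" "j \<in> R" for j
    using N_in[OF y that] zero[OF that] Ny by simp
  have "M *\<^sub>v (x - y) = 0\<^sub>v n"
  proof (rule eq_vecI)
    fix i assume "i < dim_vec (0\<^sub>v n :: 'a vec)"
    then have i: "i < n" by simp
    have "(M *\<^sub>v y) $ i = (M *\<^sub>v x) $ i"
      using M_in[OF y y_in i] N_out[OF y i] zero[OF i] Ny by (cases "i \<in> R") auto
    then show "(M *\<^sub>v (x - y)) $ i = 0\<^sub>v n $ i"
      using i M x y by (simp add: mult_minus_distrib_mat_vec[OF M x y])
  qed (use M in simp)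
  then have "x - y = 0\<^sub>v n"
    using ker x y by simp
  then have "(x - y) $ i = 0"
    using \<open>i < n\<close> by simp
  then show ?thesis
    using y_in[OF \<open>i < n\<close> \<open>i \<in> R\<close>] \<open>i < n\<close> x y by simp
qed

text \<open>Extending an eigenvector of the block by zero gives a vector \<open>x\<close> that \<open>A - \<lambda>\<close> maps to a vector
  vanishing on \<open>R\<close>: on \<open>S\<close> by the eigenvector equation, on \<open>R - S\<close> because that set is closed and \<open>x\<close>
  vanishes there. If \<open>A - \<lambda>\<close> were injective, \<open>x\<close> would vanish on \<open>R\<close>, hence be zero.\<close>

lemma eigenvalue_diagonal_block:
  fixes A :: "'a :: field mat"
  assumes A: "A \<in> carrier_mat n n" and f: "bij_betw f {..<k} S"
    and S: "S \<subseteq> {..<n}" "S \<subseteq> R"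
    and closed: "\<And>i j. i < n \<Longrightarrow> j < n \<Longrightarrow> i \<in> R \<Longrightarrow> j \<notin> R \<Longrightarrow> A $$ (i, j) = 0"
    and closed': "\<And>i j. i < n \<Longrightarrow> j < n \<Longrightarrow> i \<in> R - S \<Longrightarrow> j \<notin> R - S \<Longrightarrow> A $$ (i, j) = 0"
    and ev: "eigenvalue (mat k k (\<lambda>(i, j). A $$ (f i, f j))) z"
  shows "eigenvalue A z"
proof (rule ccontr)
  assume no_ev: "\<not> eigenvalue A z"
  define M where "M = char_matrix A z"
  have M: "M \<in> carrier_mat n n"
    using A by (simp add: M_def)
  have M_entry: "M $$ (i, j) = A $$ (i, j) - (if i = j then z else 0)" if "i < n" "j < n" for i j
    using that A by (simp add: M_def char_matrix_def)
  have ker: "x = 0\<^sub>v n" if "x \<in> carrier_vec n" "M *\<^sub>v x = 0\<^sub>v n" for x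
    using no_ev that eigenvalue_char_matrix[OF A] unfolding M_def by blast
  obtain y where y: "y \<in> carrier_vec k" "y \<noteq> 0\<^sub>v k"
    and Ay: "mat k k (\<lambda>(i, j). A $$ (f i, f j)) *\<^sub>v y = z \<cdot>\<^sub>v y"
    using ev unfolding eigenvalue_def eigenvector_def by auto
  define x where "x = vec n (\<lambda>i. if i \<in> S then y $ the_inv_into {..<k} f i else 0)"
  have x: "x \<in> carrier_vec n"
    by (simp add: x_def)
  have f_less: "f l < n" and f_in: "f l \<in> S" if "l < k" for l
    using that f S(1) by (auto simp: bij_betw_def)
  have x_f: "x $ f l = y $ l" if "l < k" for l
    using that f f_less[OF that] f_in[OF that] by (simp add: x_def bij_betw_def the_inv_into_f_f)
  have Ax: "(A *\<^sub>v x) $ i = (\<Sum>j\<in>S. A $$ (i, j) * x $ j)" if "i < n" for i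
  proof -
    have "(A *\<^sub>v x) $ i = (\<Sum>j<n. A $$ (i, j) * x $ j)"
      using that A x by (simp add: scalar_prod_def atLeast0LessThan)
    also have "\<dots> = (\<Sum>j\<in>S. A $$ (i, j) * x $ j)"
      using S(1) by (intro sum.mono_neutral_right) (auto simp: x_def)
    finally show ?thesis .
  qed
  have Mx: "(M *\<^sub>v x) $ i = (A *\<^sub>v x) $ i - z * x $ i" if "i < n" for i
  proof -
    have "(M *\<^sub>v x) $ i = (\<Sum>j<n. A $$ (i, j) * x $ j - (if i = j then z * x $ j else 0))"
      using that M x by (auto simp: scalar_prod_def atLeast0LessThan M_entry left_diff_distrib intro!: sum.cong)
    also have "\<dots> = (A *\<^sub>v x) $ i - z * x $ i"
      using that A x by (simp add: sum_subtractf scalar_prod_def atLeast0LessThan)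
    finally show ?thesis .
  qed
  have Mx_zero: "(M *\<^sub>v x) $ i = 0" if i: "i < n" "i \<in> R" for i
  proof (cases "i \<in> S")
    case True
    then obtain l where l: "l < k" "i = f l"
      using f by (auto simp: bij_betw_def)
    have "(A *\<^sub>v x) $ i = (\<Sum>m<k. A $$ (f l, f m) * y $ m)"
      unfolding Ax[OF i(1)] sum.reindex_bij_betw[OF f, symmetric] by (simp add: l x_f)
    also have "\<dots> = (mat k k (\<lambda>(i, j). A $$ (f i, f j)) *\<^sub>v y) $ l"
      using l y by (simp add: scalar_prod_def atLeast0LessThan)
    also have "\<dots> = z * x $ i"
      using l y by (simp add: Ay x_f)
    finally show ?thesis
      using Mx[OF i(1)] by simp
  next
    case False
    have "A $$ (i, j) = 0" if "j \<in> S" for j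
      using that False i S(1) by (intro closed') auto
    then have "(A *\<^sub>v x) $ i = 0"
      unfolding Ax[OF i(1)] by simp
    then show ?thesis
      using Mx[OF i(1)] False i by (simp add: x_def)
  qed
  have M_closed: "M $$ (i, j) = 0" if "i < n" "j < n" "i \<in> R" "j \<notin> R" for i j
    using that closed M_entry by auto
  have "y $ l = 0" if "l < k" for l
    using vanishes_on_closed_set[OF M ker M_closed x Mx_zero f_less[OF that]]
      f_in[OF that] S(2) x_f[OF that] by auto
  then have "y = 0\<^sub>v k"
    using y(1) by (intro eq_vecI) auto
  with y(2) show False by blast
qed

lemma stable_mat_diagonal_block_nonzero:
  assumes A: "A \<in> carrier_mat n n" and stable: "stable_mat A"
    and S: "S \<subseteq> {..<n}" "S \<subseteq> R" "S \<noteq> {}"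
    and closed: "\<And>i j. i < n \<Longrightarrow> j < n \<Longrightarrow> i \<in> R \<Longrightarrow> j \<notin> R \<Longrightarrow> A $$ (i, j) = 0"
    and closed': "\<And>i j. i < n \<Longrightarrow> j < n \<Longrightarrow> i \<in> R - S \<Longrightarrow> j \<notin> R - S \<Longrightarrow> A $$ (i, j) = 0"
  shows "\<exists>i\<in>S. A $$ (i, i) \<noteq> 0"
proof (rule ccontr)
  assume "\<not> ?thesis"
  then have diag: "A $$ (i, i) = 0" if "i \<in> S" for i
    using that by blast
  have "finite S"
    using S(1) finite_subset by blast
  then obtain f where f: "bij_betw f {..<card S} S"
    using ex_bij_betw_nat_finite[of S] by (auto simp: atLeast0LessThan)
  define k where "k = card S"
  define A\<^sub>c where "A\<^sub>c = map_mat complex_of_real A"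
  define B where "B = mat k k (\<lambda>(i, j). A\<^sub>c $$ (f i, f j))"
  have f_less: "f i < n" and f_in: "f i \<in> S" if "i < k" for i
    using that f S(1) by (auto simp: bij_betw_def k_def)
  have "Re z < 0" if "eigenvalue B z" for z
  proof -
    have "eigenvalue A\<^sub>c z"
      using that A closed closed' unfolding B_def
      by (intro eigenvalue_diagonal_block[of A\<^sub>c n f k S R] f[folded k_def] S(1,2))
         (auto simp: A\<^sub>c_def)
    then show ?thesis
      using stable by (simp add: stable_mat_def A\<^sub>c_def)
  qed
  moreover have "k > 0"
    using \<open>finite S\<close> S(3) by (simp add: k_def card_gt_0_iff)
  ultimately have "Re (\<Sum>i<k. B $$ (i, i)) < 0"
    by (intro Re_trace_neg) (auto simp: B_def)
  moreover have "B $$ (i, i) = 0" if "i < k" for i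
    using that A f_less[OF that] diag[OF f_in[OF that]] by (simp add: B_def A\<^sub>c_def)
  ultimately show False by simp
qed

section \<open>Strongly connected components\<close>

theorem theorem1:
  fixes n :: nat and \<alpha> :: "(nat \<times> nat) set"
  assumes "n \<ge> 1"
    and "\<alpha> \<subseteq> {1..n} \<times> {1..n}"
    and "stable_space (SMS n \<alpha>)"
  shows "\<forall>v\<in>verts (sms_digraph n \<alpha>). \<exists>C\<in>pre_digraph.sccs (sms_digraph n \<alpha>).
           v \<in> verts C \<and> (\<exists>w\<in>verts C. is_sink (sms_digraph n \<alpha>) w)"
proof
  fix v assume v: "v \<in> verts (sms_digraph n \<alpha>)"
  let ?G = "sms_digraph n \<alpha>"
  interpret wf_digraph ?G
    by unfold_locales (use assms(2) in \<open>auto simp: sms_digraph_def\<close>)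
  obtain A where A: "A \<in> SMS n \<alpha>" "stable_mat A"
    using assms(3) unfolding stable_space_def by blast
  have carrier: "A \<in> carrier_mat n n"
    using A(1) by (simp add: SMS_def)
  \<comment> \<open>Matrix index \<open>i\<close> stands for the vertex \<open>Suc i\<close>.\<close>
  have edge: "(Suc i, Suc j) \<in> \<alpha>" if "i < n" "j < n" "A $$ (i, j) \<noteq> 0" for i j
    using A(1) that by (force simp: SMS_def)
  have adj: "Suc i \<rightarrow>\<^bsub>?G\<^esub> Suc j" if "i < n" "j < n" "A $$ (i, j) \<noteq> 0" for i j
    using edge[OF that] by (force simp: arcs_ends_conv sms_digraph_def)
  define R where "R = {i. v \<rightarrow>\<^sup>*\<^bsub>?G\<^esub> Suc i}"
  define S where "S = {i. Suc i \<in> scc_of v}"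
  have "\<exists>i\<in>S. A $$ (i, i) \<noteq> 0"
  proof (rule stable_mat_diagonal_block_nonzero[OF carrier A(2), where R = R])
    show "S \<subseteq> {..<n}"
    proof
      fix i assume "i \<in> S"
      then have "Suc i \<in> verts ?G"
        by (auto simp: S_def scc_of_def dest!: reachable_in_verts(2))
      then show "i \<in> {..<n}"
        by (simp add: sms_digraph_def)
    qed
    show "S \<subseteq> R"
      by (auto simp: S_def R_def scc_of_def)
    show "S \<noteq> {}"
      using in_scc_of_self[OF v] v by (cases v) (auto simp: S_def sms_digraph_def)
    show "A $$ (i, j) = 0" if "i < n" "j < n" "i \<in> R" "j \<notin> R" for i j
      using that adj reachable_adj_trans unfolding R_def by blast
    show "A $$ (i, j) = 0" if "i < n" "j < n" "i \<in> R - S" "j \<notin> R - S" for i j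
    proof (rule ccontr)
      assume "A $$ (i, j) \<noteq> 0"
      note ij = adj[OF that(1,2) this]
      have "v \<rightarrow>\<^sup>*\<^bsub>?G\<^esub> Suc j"
        using that(3) reachable_adj_trans[OF _ ij] by (simp add: R_def)
      moreover have "\<not> Suc j \<rightarrow>\<^sup>*\<^bsub>?G\<^esub> v"
        using that(3) adj_reachable_trans[OF ij] by (auto simp: R_def S_def scc_of_def)
      ultimately show False
        using that(4) by (simp add: R_def S_def scc_of_def)
    qed
  qed
  then obtain i where i: "i \<in> S" "A $$ (i, i) \<noteq> 0"
    by blast
  have "Suc i \<in> verts ?G"
    using i(1) by (auto simp: S_def scc_of_def dest!: reachable_in_verts(2))
  then have "i < n"
    by (simp add: sms_digraph_def)
  then have "is_sink ?G (Suc i)"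
    using \<open>Suc i \<in> verts ?G\<close> edge[OF _ _ i(2)] by (force simp: is_sink_def sms_digraph_def)
  moreover have "?G \<restriction> scc_of v \<in> sccs"
    by (rule in_verts_sccsD_sccs[OF scc_of_in_sccs_verts[OF v]])
  moreover have "v \<in> scc_of v"
    using v by (rule in_scc_of_self)
  moreover have "Suc i \<in> scc_of v"
    using i(1) by (simp add: S_def)
  ultimately show "\<exists>C\<in>sccs. v \<in> verts C \<and> (\<exists>w\<in>verts C. is_sink ?G w)"
    by (intro bexI[of _ "?G \<restriction> scc_of v"]) auto
qed

end
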